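(* Let $1\le p<\infty$, $0 < q, r < \infty$ and $u, v, w \in \mathcal{W}(0,\infty)$. Assume that $\{x_k\}_{k \in \mathcal{Z}}$ is a covering sequence (associated with $u$). Then the inequality $$ \bigg( \int_0^{\infty} \bigg( \int_x^{\infty} \bigg( \int_0^t h \bigg)^q w(t)\,dt \bigg)^{\frac{r}{q}} u(x)\,dx \bigg)^{\frac{1}{r}}\leq C \bigg( \int_0^{\infty} h^p v \bigg)^{\frac{1}{p}}, \qquad h \in \mathfrak{M}^+(0,\infty), $$ holds if and only if both of the inequalities $$ \bigg\| \bigg\{ 2^{\frac{k}{r}} \bigg( \int_{x_k}^{x_{k+1}} \bigg( \int_{x_k}^t h \bigg)^q w(t)\,dt \bigg)^{\frac{1}{q}} \bigg\} \bigg\|_{\ell^r(\mathcal{Z})} \le C \bigg\| \bigg\{ \bigg( \int_{x_n}^{x_{n+1}} h^p v \bigg)^{\frac{1}{p}} \bigg\} \bigg\|_{\ell^p (\mathcal{Z})}, \qquad h \in \mathfrak{M}^+(0,\infty), $$ and $$ \bigg( \int_0^{\infty} u(x) \bigg[ \sup_{s \in [x,\infty)} \bigg( \int_s^{\infty} w \bigg)^{\frac{1}{q}} \bigg( \int_0^s h\bigg) \bigg]^r \,dx \bigg)^{\frac{1}{r}} \leq C \bigg( \int_0^{\infty} h^p v \bigg)^{\frac{1}{p}}, \qquad h \in \mathfrak{M}^+(0,\infty), $$ hold.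
   Context: $\mathfrak{M}^+(0,\infty)$ is the set of all non-negative (Lebesgue) measurable functions on $(0,\infty)$. A weight is a function $v \in \mathfrak{M}^+(0,\infty)$ such that $0 < \int_0^x v(t)\,dt < \infty$ for all $x \in (0,\infty)$; $\mathcal{W}(0,\infty)$ is the set of all weights. Integrals without a displayed differential are Lebesgue integrals of the indicated function. Convention: $0\cdot\infty=0$. An inequality "holds" if there is a finite constant $C$, independent of $h$ (possibly different in different inequalities), for which it is true for all $h\in\mathfrak{M}^+(0,\infty)$. Covering sequence: let $u$ be a weight on $(0,\infty)$. If $\int_0^\infty u = \infty$, let $\mathcal{Z} = \mathbb{Z}$ and let $\{x_k\}_{k\in\mathbb{Z}} \subset (0,\infty)$ be a strictly increasing sequence such that $\int_0^{x_k} u(t)\,dt = 2^k$ for all $k \in \mathbb{Z}$. If $\int_0^\infty u < \infty$, let $M\in\mathbb{Z}$ satisfy $2^M \le \int_0^\infty u(t)\,dt < 2^{M+1}$, let $\mathcal{Z} = \{k \in \mathbb{Z} : k \le M\}$, let $\{x_k\}_{k=-\infty}^{M}$ be a strictly increasing sequence such that $\int_0^{x_k} u(t)\,dt = 2^k$ for $-\infty<k \le M$, and put $x_{M+1} := \infty$. In both cases $\bigcup_{k\in\mathcal{Z}} [x_k,x_{k+1}) = (0,\infty)$, and $\{x_k\}_{k \in \mathcal{Z}}$ is called a covering sequence. For $0<r<\infty$, $\|\{a_k\}\|_{\ell^r(\mathcal{Z})} = \big(\sum_{k\in\mathcal{Z}} |a_k|^r\big)^{1/r}$. *)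

theory Defs
  imports "HOL-Analysis.Analysis"
begin

text \<open>Non-negative functions take values in \<^typ>\<open>ennreal\<close>, whose multiplication satisfies
  \<open>0 * \<infinity> = 0\<close>. A function on the half-line is a function on the reals whose values outside
  \<open>{0<..}\<close> are never used.\<close>

definition Mplus :: "(real \<Rightarrow> ennreal) set" where
  "Mplus = borel_measurable (lebesgue_on {0<..})"

definition lint :: "ereal \<Rightarrow> ereal \<Rightarrow> (real \<Rightarrow> ennreal) \<Rightarrow> ennreal" where
  "lint a b f = (\<integral>\<^sup>+t\<in>einterval a b. f t \<partial>lebesgue)"

definition weights :: "(real \<Rightarrow> ennreal) set" where
  "weights = {v \<in> Mplus. \<forall>x::real. 0 < x \<longrightarrow> 0 < lint 0 x v \<and> lint 0 x v < \<infinity>}"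

text \<open>The power of an extended non-negative number, meaningful for exponents \<open>a > 0\<close> only.\<close>

definition epowr :: "ennreal \<Rightarrow> real \<Rightarrow> ennreal" where
  "epowr x a = (if x = \<infinity> then \<infinity> else ennreal (enn2real x powr a))"

definition lnorm :: "real \<Rightarrow> int set \<Rightarrow> (int \<Rightarrow> ennreal) \<Rightarrow> ennreal" where
  "lnorm r Z a = epowr (\<integral>\<^sup>+k. epowr (a k) r \<partial>count_space Z) (1 / r)"

text \<open>In the second case the points \<open>x k\<close> with \<open>k < M\<close> are finite by strict monotonicity, but
  \<open>x M = \<infinity>\<close> is permitted: if \<open>lint 0 \<infinity> u\<close> is exactly \<open>2 powi M\<close>, there need not be a finite point
  with \<open>lint 0 (x M) u = 2 powi M\<close>. The interval from \<open>x M\<close> to \<open>x (M + 1)\<close> is then empty.\<close>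

definition covering_sequence :: "(real \<Rightarrow> ennreal) \<Rightarrow> int set \<Rightarrow> (int \<Rightarrow> ereal) \<Rightarrow> bool" where
  "covering_sequence u Z x \<longleftrightarrow>
     (lint 0 \<infinity> u = \<infinity> \<and> Z = UNIV \<and> strict_mono x \<and>
       (\<forall>k. 0 < x k \<and> x k < \<infinity> \<and> lint 0 (x k) u = ennreal (2 powi k))) \<or>
     (lint 0 \<infinity> u < \<infinity> \<and>
       (\<exists>M. ennreal (2 powi M) \<le> lint 0 \<infinity> u \<and> lint 0 \<infinity> u < ennreal (2 powi (M + 1)) \<and>
          Z = {..M} \<and> strict_mono_on {..M} x \<and>
          (\<forall>k\<le>M. 0 < x k \<and> lint 0 (x k) u = ennreal (2 powi k)) \<and> x (M + 1) = \<infinity>))"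

end

theory Submission
  imports Defs
begin

text \<open>
  Write \<open>H(t) = \<integral>\<^sub>0\<^sup>t h\<close> and \<open>F(y) = \<integral>\<^sub>y\<^sup>\<infinity> H\<^sup>q w\<close>. Up to \<open>r\<close>-th roots, the left-hand sides are
  \<open>I = \<integral>\<^sub>0\<^sup>\<infinity> F\<^sup>r\<^sup>/\<^sup>q u\<close> for the original inequality, a dyadic sum \<open>S\<close> for the local ones, and the
  weighted integral \<open>T\<close> of a supremum. All right-hand sides agree, since the pieces of the covering
  sequence exhaust the half-line up to a null set. So it suffices to compare \<open>I\<close> with \<open>S\<close> and \<open>T\<close>
  for each fixed \<open>h\<close>, with constants independent of \<open>h\<close>: \<open>T \<le> I\<close>, \<open>S \<le> 2 I\<close>, and
  \<open>I \<le> c (S + T)\<close>.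

  The bound \<open>T \<le> I\<close> is pointwise (\<open>sup_kernel_le\<close>): for \<open>s \<ge> y\<close>, monotonicity of \<open>H\<close> gives
  \<open>H(s)\<^sup>q \<integral>\<^sub>s\<^sup>\<infinity> w \<le> \<integral>\<^sub>s\<^sup>\<infinity> H\<^sup>q w \<le> F(y)\<close>.

  For the other two, the integral of a decreasing function against \<open>u\<close> is compared with a dyadic
  sum. By the choice of the \<open>x k\<close>, the weight \<open>u\<close> has mass exactly \<open>2\<^sup>k\<^sup>-\<^sup>1\<close> on the piece before
  \<open>x k\<close> and mass at most \<open>2\<^sup>k\<close> on the piece after it; hence \<open>\<integral> g u\<close> is at least half of
  \<open>\<Sum> 2\<^sup>k g(x k)\<close> and at most this sum (\<open>sum_le_weighted_integral\<close>, \<open>weighted_integral_le_sum\<close>).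
  The lower estimate for \<open>g = F\<^sup>r\<^sup>/\<^sup>q\<close> gives \<open>S \<le> 2 I\<close>.

  For the upper bound of \<open>I\<close>, the value \<open>F(x k)\<close> is a tail sum of the integrals of \<open>H\<^sup>q w\<close> over
  the pieces. Since the weights \<open>2\<^sup>k\<close> grow geometrically, the tails may be replaced by their first
  terms at the cost of a constant (\<open>discrete_hardy\<close>). On a single piece, \<open>H(t)\<close> is \<open>H(x k)\<close> plus
  the integral of \<open>h\<close> from \<open>x k\<close> to \<open>t\<close>. The second summand leads to \<open>S\<close>. The first is a constant
  on the piece and leads to \<open>2\<^sup>k (H(x k)\<^sup>q \<integral> w)\<^sup>r\<^sup>/\<^sup>q\<close>, which the term \<open>s = x k\<close> of the supremum bounds;
  the lower discretisation then yields \<open>2 T\<close>.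
\<close>

section \<open>Powers of extended non-negative numbers\<close>

lemma epowr_top [simp]: "epowr \<infinity> a = \<infinity>" "epowr top a = top"
  by (simp_all add: epowr_def)

lemma epowr_ennreal: "0 \<le> t \<Longrightarrow> epowr (ennreal t) a = ennreal (t powr a)"
  by (simp add: epowr_def)

lemma epowr_0 [simp]: "epowr 0 a = 0"
  by (simp add: epowr_def)

lemma epowr_1 [simp]: "epowr s 1 = s"
  by (cases s) (simp_all add: epowr_def)

lemma epowr_finite: "s < \<infinity> \<Longrightarrow> epowr s a < \<infinity>"
  by (simp add: epowr_def)

lemma epowr_mono:
  assumes "0 < a" "s \<le> t"
  shows "epowr s a \<le> epowr t a"
  using assms by (cases s; cases t) (auto simp: epowr_ennreal top_unique intro!: ennreal_leI powr_mono2)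

text \<open>The convention \<open>0 * \<infinity> = 0\<close> is compatible with this law because
  \<open>epowr 0 a = 0\<close> and \<open>epowr \<infinity> a = \<infinity>\<close>.\<close>

lemma epowr_mult: "0 < a \<Longrightarrow> epowr (s * t) a = epowr s a * epowr t a"
  by (cases s; cases t)
    (auto simp: epowr_ennreal ennreal_mult[symmetric] powr_mult ennreal_mult_top ennreal_top_mult)

lemma epowr_epowr: "epowr (epowr s a) b = epowr s (a * b)"
  by (cases s) (auto simp: epowr_ennreal powr_powr)

text \<open>This replaces the triangle inequality for all exponents at once:
  \<open>s + t \<le> 2 max s t\<close>, and the power of the maximum is one of the two powers.\<close>

lemma epowr_add_le:
  assumes "0 < a"
  shows "epowr (s + t) a \<le> ennreal (2 powr a) * (epowr s a + epowr t a)"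
proof -
  have "s + t \<le> 2 * max s t"
    by (metis add_mono max.cobounded1 max.cobounded2 mult_2)
  then have "epowr (s + t) a \<le> epowr (ennreal 2 * max s t) a"
    using assms by (intro epowr_mono) auto
  also have "\<dots> = ennreal (2 powr a) * epowr (max s t) a"
    using assms by (simp only: epowr_mult epowr_ennreal)
  also have "\<dots> \<le> ennreal (2 powr a) * (epowr s a + epowr t a)"
    by (intro mult_left_mono) (auto simp: max_def)
  finally show ?thesis .
qed

section \<open>Integrals over intervals of the half-line\<close>

text \<open>Extending a function by zero turns measurability on the half-line into measurability on the
  whole line, where the integration theorems apply.\<close>

lemma Mplus_iff: "f \<in> Mplus \<longleftrightarrow> (\<lambda>t. f t * indicator {0<..} t) \<in> borel_measurable lebesgue"
  unfolding Mplus_def by (rule borel_measurable_restrict_space_iff_ennreal) simp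

lemma Mplus_mult: "f \<in> Mplus \<Longrightarrow> g \<in> Mplus \<Longrightarrow> (\<lambda>t. f t * g t) \<in> Mplus"
  by (simp add: Mplus_def)

lemma Mplus_epowr:
  assumes "f \<in> Mplus"
  shows "(\<lambda>t. epowr (f t) a) \<in> Mplus"
  using assms unfolding Mplus_def epowr_def by measurable

text \<open>Monotone and antitone functions are measurable since their superlevel or sublevel sets are
  up-closed. The iterated integrals and the supremum in the inequalities depend monotonically
  or antitonically on their end point and are measurable for this reason.\<close>

lemma up_closed_real_borel:
  fixes S :: "real set"
  assumes "\<And>s t. s \<in> S \<Longrightarrow> s \<le> t \<Longrightarrow> t \<in> S"
  shows "S \<in> sets borel"
proof -
  have "is_interval S" using assms unfolding is_interval_1 by blast
  then show ?thesis by (rule real_interval_borel_measurable)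
qed

lemma Mplus_mono:
  fixes f :: "real \<Rightarrow> ennreal"
  assumes "mono f"
  shows "f \<in> Mplus"
proof -
  have "f \<in> borel_measurable borel"
    using assms by (intro borel_measurableI_greater) (auto intro!: up_closed_real_borel dest: monoD intro: less_le_trans)
  then show ?thesis
    unfolding Mplus_def by (intro measurable_restrict_space1) (simp add: measurable_completion)
qed

lemma Mplus_antimono:
  fixes f :: "real \<Rightarrow> ennreal"
  assumes "antimono f"
  shows "f \<in> Mplus"
proof -
  have "f \<in> borel_measurable borel"
    using assms by (intro borel_measurableI_less) (auto intro!: up_closed_real_borel dest: antimonoD intro: le_less_trans)
  then show ?thesis
    unfolding Mplus_def by (intro measurable_restrict_space1) (simp add: measurable_completion)
qed

lemma Mplus_einterval_measurable:
  assumes "f \<in> Mplus" "0 \<le> a"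
  shows "(\<lambda>t. f t * indicator (einterval a b) t) \<in> borel_measurable lebesgue"
proof -
  have *: "(\<lambda>t. f t * indicator (einterval a b) t)
      = (\<lambda>t. (f t * indicator {0<..} t) * indicator (einterval a b) t)"
    using assms(2) by (auto simp: fun_eq_iff einterval_iff indicator_def
        dest: le_less_trans[of 0 a])
  have "einterval a b \<in> sets lebesgue" by simp
  with assms(1) show ?thesis unfolding * Mplus_iff by measurable
qed

text \<open>This holds for arbitrary functions, because \<^const>\<open>nn_integral\<close>, a supremum over simple functions, is
  monotone without measurability. In particular \<open>lint\<close> is monotone in its end points on the whole
  real line, also for integrands that are meaningful only on \<open>{0<..}\<close>.\<close>

lemma lint_mono:
  assumes "a' \<le> a" "b \<le> b'" "\<And>t. a < ereal t \<Longrightarrow> ereal t < b \<Longrightarrow> f t \<le> g t"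
  shows "lint a b f \<le> lint a' b' g"
  unfolding lint_def
  by (intro nn_integral_mono)
    (use assms in \<open>auto simp: einterval_iff indicator_def dest: le_less_trans less_le_trans\<close>)

lemma lint_cmult:
  assumes "f \<in> Mplus" "0 \<le> a"
  shows "lint a b (\<lambda>t. c * f t) = c * lint a b f"
  unfolding lint_def
  using nn_integral_cmult[OF Mplus_einterval_measurable[OF assms], of c b] by (simp add: mult.assoc)

lemma lint_add:
  assumes "f \<in> Mplus" "g \<in> Mplus" "0 \<le> a"
  shows "lint a b (\<lambda>t. f t + g t) = lint a b f + lint a b g"
  unfolding lint_def
  using nn_integral_add[OF Mplus_einterval_measurable[OF assms(1,3), of b] 
      Mplus_einterval_measurable[OF assms(2,3), of b]] by (simp add: distrib_right)

lemma lint_mono_right: "mono (\<lambda>t. lint a (ereal t) f)"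
  by (intro monoI lint_mono) auto

lemma lint_antimono_left: "antimono (\<lambda>t. lint (ereal t) b f)"
  by (intro antimonoI lint_mono) auto

lemma lint_empty: "b \<le> a \<Longrightarrow> lint a b f = 0"
proof -
  assume "b \<le> a"
  then have "indicator (einterval a b) t = (0 :: ennreal)" for t
    by (auto simp: einterval_iff indicator_def)
  then show ?thesis by (simp add: lint_def)
qed

text \<open>The intervals are open, so their union may miss the left end points. Those are countably many
  and carry no mass.\<close>

lemma lint_le_sum:
  fixes y y' :: "'i \<Rightarrow> ereal"
  assumes f: "f \<in> Mplus" and J: "countable J" and y: "\<And>k. k \<in> J \<Longrightarrow> 0 \<le> y k"
    and cover: "\<And>t. a < ereal t \<Longrightarrow> ereal t < b \<Longrightarrow>
       ereal t \<in> y ` J \<or> (\<exists>k\<in>J. y k < ereal t \<and> ereal t < y' k)"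
  shows "lint a b f \<le> (\<integral>\<^sup>+k. lint (y k) (y' k) f \<partial>count_space J)"
proof -
  have "(real_of_ereal ` y ` J) \<in> null_sets lebesgue"
    using J by (intro null_sets_completionI countable_imp_null_set_lborel) auto
  then have "AE t in lebesgue. t \<notin> real_of_ereal ` y ` J"
    by (rule AE_not_in)
  then have "lint a b f
      \<le> (\<integral>\<^sup>+t. \<integral>\<^sup>+k. f t * indicator (einterval (y k) (y' k)) t \<partial>count_space J \<partial>lebesgue)"
    unfolding lint_def
  proof (intro nn_integral_mono_AE, eventually_elim)
    case (elim t)
    show ?case
    proof (cases "t \<in> einterval a b")
      case True
      then have "ereal t \<in> y ` J \<or> (\<exists>k\<in>J. y k < ereal t \<and> ereal t < y' k)"
        using cover by (auto simp: einterval_iff)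
      moreover have "ereal t \<notin> y ` J"
        using elim by (metis image_eqI real_of_ereal.simps(1))
      ultimately obtain k where k: "k \<in> J" "y k < ereal t" "ereal t < y' k" by blast
      then have "f t * indicator (einterval a b) t = f t * indicator (einterval (y k) (y' k)) t"
        using True by (simp add: einterval_iff indicator_def)
      also have "\<dots> \<le> (\<integral>\<^sup>+k. f t * indicator (einterval (y k) (y' k)) t \<partial>count_space J)"
        by (rule nn_integral_ge_point[OF k(1)])
      finally show ?thesis .
    qed simp
  qed
  also have "\<dots> = (\<integral>\<^sup>+k. lint (y k) (y' k) f \<partial>count_space J)"
    unfolding lint_def
    by (intro nn_integral_count_space_nn_integral J Mplus_einterval_measurable f y)
  finally show ?thesis .
qed

text \<open>At every point at most one of the disjoint intervals contributes to the sum of indicators.\<close>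

lemma sum_lint_le:
  fixes y y' :: "'i \<Rightarrow> ereal"
  assumes f: "f \<in> Mplus" and J: "countable J" and y: "\<And>k. k \<in> J \<Longrightarrow> 0 \<le> y k"
    and sub: "\<And>k. k \<in> J \<Longrightarrow> a \<le> y k \<and> y' k \<le> b"
    and disj: "\<And>i k. i \<in> J \<Longrightarrow> k \<in> J \<Longrightarrow> i \<noteq> k \<Longrightarrow> y' i \<le> y k \<or> y' k \<le> y i"
  shows "(\<integral>\<^sup>+k. lint (y k) (y' k) f \<partial>count_space J) \<le> lint a b f"
proof -
  have "(\<integral>\<^sup>+k. lint (y k) (y' k) f \<partial>count_space J)
      = (\<integral>\<^sup>+t. \<integral>\<^sup>+k. f t * indicator (einterval (y k) (y' k)) t \<partial>count_space J \<partial>lebesgue)"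
    unfolding lint_def
    by (intro nn_integral_count_space_nn_integral[symmetric] J Mplus_einterval_measurable f y)
  also have "\<dots> \<le> lint a b f"
    unfolding lint_def
  proof (rule nn_integral_mono)
    fix t
    show "(\<integral>\<^sup>+k. f t * indicator (einterval (y k) (y' k)) t \<partial>count_space J)
        \<le> f t * indicator (einterval a b) t"
    proof (cases "\<exists>k\<in>J. t \<in> einterval (y k) (y' k)")
      case True
      then obtain k where k: "k \<in> J" "t \<in> einterval (y k) (y' k)" by blast
      have "t \<notin> einterval (y i) (y' i)" if "i \<in> J" "i \<noteq> k" for i
        using disj[of i k] that k by (auto simp: einterval_iff)
      then have "(\<integral>\<^sup>+k. f t * indicator (einterval (y k) (y' k)) t \<partial>count_space J)
          = (\<Sum>k\<in>{k}. f t * indicator (einterval (y k) (y' k)) t)"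
        using k by (intro nn_integral_count_space') (auto simp: indicator_def)
      also have "\<dots> = f t * indicator (einterval a b) t"
        using k sub[OF k(1)] by (auto simp: einterval_iff indicator_def dest: le_less_trans less_le_trans)
      finally show ?thesis by simp
    next
      case False
      then have "(\<integral>\<^sup>+k. f t * indicator (einterval (y k) (y' k)) t \<partial>count_space J) = 0"
        by (subst nn_integral_cong[where v = "\<lambda>_. 0"]) (auto simp: indicator_def)
      then show ?thesis by simp
    qed
  qed
  finally show ?thesis .
qed

lemma lint_split:
  assumes f: "f \<in> Mplus" and "0 \<le> a" "a \<le> b" "b \<le> c"
  shows "lint a c f = lint a b f + lint b c f"
proof -
  let ?y = "\<lambda>i::bool. if i then b else a" and ?y' = "\<lambda>i. if i then c else b"
  have *: "(\<integral>\<^sup>+k. lint (?y k) (?y' k) f \<partial>count_space UNIV) = lint a b f + lint b c f"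
    by (simp add: nn_integral_count_space_finite UNIV_bool add.commute)
  have "lint a c f \<le> (\<integral>\<^sup>+k. lint (?y k) (?y' k) f \<partial>count_space UNIV)"
    using assms by (intro lint_le_sum) (auto simp: UNIV_bool)
  moreover have "(\<integral>\<^sup>+k. lint (?y k) (?y' k) f \<partial>count_space UNIV) \<le> lint a c f"
    using assms by (intro sum_lint_le) auto
  ultimately show ?thesis unfolding * by (rule antisym)
qed

section \<open>A discrete Hardy inequality\<close>

text \<open>The two sums are the same geometric series, read upwards from \<open>k\<close> and downwards from \<open>k\<close>;
  the point is that the value does not depend on \<open>k\<close>.\<close>

lemma geometric_sums:
  assumes "0 < d"
  obtains c where "c < \<infinity>"
    "\<And>k. (\<integral>\<^sup>+j. ennreal (2 powr (d * real_of_int (k - j))) \<partial>count_space {k..}) = c"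
    "\<And>k. (\<integral>\<^sup>+j. ennreal (2 powr (d * real_of_int (j - k))) \<partial>count_space {..k}) = c"
proof
  let ?c = "\<Sum>n. ennreal ((2 powr - d) ^ n)"
  have geo: "ennreal (2 powr (d * real_of_int (- int n))) = ennreal ((2 powr - d) ^ n)" for n
    by (simp add: powr_realpow[symmetric] powr_powr)
  have "summable (\<lambda>n. (2 powr - d) ^ n :: real)"
    using assms by (intro summable_geometric) (simp add: powr_less_one)
  then show "?c < \<infinity>"
    using ennreal_suminf_neq_top by (auto simp: less_top)
  fix k :: int
  have "bij_betw (\<lambda>n. k + int n) UNIV {k..}"
    by (rule bij_betwI[where g = "\<lambda>j. nat (j - k)"]) auto
  note bij = nn_integral_bij_count_space[OF this, symmetric]
  show "(\<integral>\<^sup>+j. ennreal (2 powr (d * real_of_int (k - j))) \<partial>count_space {k..}) = ?c"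
    by (subst bij) (use geo in \<open>simp add: nn_integral_count_space_nat\<close>)
  have "bij_betw (\<lambda>n. k - int n) UNIV {..k}"
    by (rule bij_betwI[where g = "\<lambda>j. nat (k - j)"]) auto
  note bij = nn_integral_bij_count_space[OF this, symmetric]
  show "(\<integral>\<^sup>+j. ennreal (2 powr (d * real_of_int (j - k))) \<partial>count_space {..k}) = ?c"
    by (subst bij) (use geo in \<open>simp add: nn_integral_count_space_nat\<close>)
qed

lemma nn_integral_count_space_mono_set:
  assumes "A \<subseteq> B"
  shows "(\<integral>\<^sup>+i. f i \<partial>count_space A) \<le> (\<integral>\<^sup>+i. f i \<partial>count_space B)"
proof -
  have "(\<integral>\<^sup>+i. f i \<partial>count_space A) = (\<integral>\<^sup>+i. f i * indicator A i \<partial>count_space B)"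
    using nn_integral_restrict_space[of A "count_space B" f] assms
    by (simp add: restrict_count_space Int_absorb2)
  also have "\<dots> \<le> (\<integral>\<^sup>+i. f i \<partial>count_space B)"
    by (intro nn_integral_mono) (simp add: indicator_def)
  finally show ?thesis .
qed

text \<open>A weighted \<open>\<ell>\<^sup>b\<close> norm of the tail controls its sum, for every \<open>b > 0\<close>. Write \<open>T\<close> for the sum on
  the right. Each summand of \<open>T\<close> is at most \<open>T\<close>, which bounds \<open>a j\<close> by a geometrically decaying
  multiple of \<open>epowr T (1 / b)\<close>; summing over \<open>j\<close> costs only a geometric series. Passing through the largest
  summand avoids treating \<open>b \<le> 1\<close> (subadditivity) and \<open>b > 1\<close> (Hoelder) separately.\<close>

lemma tail_sum_epowr_le:
  assumes "0 < b"
  obtains c where "c < \<infinity>"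
    "\<And>(a :: int \<Rightarrow> ennreal) Z k. epowr (\<integral>\<^sup>+j. a j \<partial>count_space (Z \<inter> {k..})) b
       \<le> c * (\<integral>\<^sup>+j. ennreal (2 powr (real_of_int (j - k) / 2)) * epowr (a j) b \<partial>count_space (Z \<inter> {k..}))"
proof -
  \<comment> \<open>With this rate \<open>2 powr (d * n)\<close> has \<open>b\<close>-th power \<open>2 powr (n / 2)\<close>.\<close>
  define d where "d = 1 / (2 * b)"
  have d: "0 < d" using assms by (simp add: d_def)
  obtain c where c: "c < \<infinity>"
    "\<And>k. (\<integral>\<^sup>+j. ennreal (2 powr (d * real_of_int (k - j))) \<partial>count_space {k..}) = c"
    using geometric_sums[OF d] by metis
  show thesis
  proof
    show "epowr c b < \<infinity>" using c(1) by (rule epowr_finite)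
    fix a :: "int \<Rightarrow> ennreal" and Z k
    define T where "T = (\<integral>\<^sup>+j. ennreal (2 powr (real_of_int (j - k) / 2)) * epowr (a j) b \<partial>count_space (Z \<inter> {k..}))"
    have "a j \<le> ennreal (2 powr (d * real_of_int (k - j))) * epowr T (1 / b)" if j: "j \<in> Z \<inter> {k..}" for j
    proof -
      have "ennreal (2 powr (real_of_int (j - k) / 2)) * epowr (a j) b \<le> T"
        unfolding T_def by (rule nn_integral_ge_point[OF j])
      then have "epowr (ennreal (2 powr (real_of_int (j - k) / 2)) * epowr (a j) b) (1 / b) \<le> epowr T (1 / b)"
        using assms by (intro epowr_mono) auto
      then have "ennreal (2 powr (d * real_of_int (j - k))) * a j \<le> epowr T (1 / b)"
        using assms by (simp add: epowr_mult epowr_epowr epowr_ennreal powr_powr d_def mult.commute)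
      then have "ennreal (2 powr (d * real_of_int (k - j))) * (ennreal (2 powr (d * real_of_int (j - k))) * a j)
          \<le> ennreal (2 powr (d * real_of_int (k - j))) * epowr T (1 / b)"
        by (rule mult_left_mono) simp
      moreover have "ennreal (2 powr (d * real_of_int (k - j))) * ennreal (2 powr (d * real_of_int (j - k))) = 1"
        by (simp add: ennreal_mult[symmetric] powr_add[symmetric] algebra_simps)
      ultimately show ?thesis by (simp add: mult.assoc[symmetric])
    qed
    then have "(\<integral>\<^sup>+j. a j \<partial>count_space (Z \<inter> {k..}))
        \<le> (\<integral>\<^sup>+j. ennreal (2 powr (d * real_of_int (k - j))) * epowr T (1 / b) \<partial>count_space (Z \<inter> {k..}))"
      by (intro nn_integral_mono) simp
    also have "\<dots> \<le> (\<integral>\<^sup>+j. ennreal (2 powr (d * real_of_int (k - j))) * epowr T (1 / b) \<partial>count_space {k..})"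
      by (rule nn_integral_count_space_mono_set) simp
    also have "\<dots> = c * epowr T (1 / b)"
      by (subst nn_integral_multc) (simp_all only: c, simp)
    finally have "epowr (\<integral>\<^sup>+j. a j \<partial>count_space (Z \<inter> {k..})) b \<le> epowr (c * epowr T (1 / b)) b"
      using assms by (intro epowr_mono)
    also have "\<dots> = epowr c b * T"
      using assms by (simp add: epowr_mult epowr_epowr)
    finally show "epowr (\<integral>\<^sup>+j. a j \<partial>count_space (Z \<inter> {k..})) b \<le> epowr c b * T" .
  qed
qed

text \<open>After the tail estimate, exchanging the two sums leaves, for each \<open>j\<close>, the weights
  \<open>2 powi k * 2 powr ((j - k) / 2) = 2 powi j * 2 powr ((k - j) / 2)\<close> with \<open>k \<le> j\<close>. They sum to a constant times \<open>2 powi j\<close>; any growth rate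
  strictly between \<open>1\<close> and \<open>2\<close> in the tail estimate would do in place of \<open>\<surd>2\<close>.\<close>

lemma discrete_hardy:
  assumes "0 < b"
  obtains c where "c < \<infinity>"
    "\<And>(a :: int \<Rightarrow> ennreal) Z.
       (\<integral>\<^sup>+k. ennreal (2 powi k) * epowr (\<integral>\<^sup>+j. a j \<partial>count_space (Z \<inter> {k..})) b \<partial>count_space Z)
       \<le> c * (\<integral>\<^sup>+j. ennreal (2 powi j) * epowr (a j) b \<partial>count_space Z)"
proof -
  obtain c where c: "c < \<infinity>"
    "\<And>(a :: int \<Rightarrow> ennreal) Z k. epowr (\<integral>\<^sup>+j. a j \<partial>count_space (Z \<inter> {k..})) b
       \<le> c * (\<integral>\<^sup>+j. ennreal (2 powr (real_of_int (j - k) / 2)) * epowr (a j) b \<partial>count_space (Z \<inter> {k..}))"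
    using tail_sum_epowr_le[OF assms] by metis
  obtain c' where c': "c' < \<infinity>"
    "\<And>k. (\<integral>\<^sup>+j. ennreal (2 powr ((1 / 2) * real_of_int (j - k))) \<partial>count_space {..k}) = c'"
    using geometric_sums[of "1 / 2"] by (metis zero_less_divide_1_iff zero_less_numeral)
  show thesis
  proof
    show "c * c' < \<infinity>" using c(1) c'(1) by (simp add: ennreal_mult_less_top)
    fix a :: "int \<Rightarrow> ennreal" and Z
    define A where "A j = ennreal (2 powi j) * epowr (a j) b" for j
    have "ennreal (2 powi k) * epowr (\<integral>\<^sup>+j. a j \<partial>count_space (Z \<inter> {k..})) b
       \<le> c * (\<integral>\<^sup>+j. A j * ennreal (2 powr ((1 / 2) * real_of_int (k - j))) * indicator {..j} k \<partial>count_space Z)" 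
      (is "_ \<le> c * ?R") for k
    proof -
      have "ennreal (2 powi k) * epowr (\<integral>\<^sup>+j. a j \<partial>count_space (Z \<inter> {k..})) b
         \<le> ennreal (2 powi k) * (c * (\<integral>\<^sup>+j. ennreal (2 powr (real_of_int (j - k) / 2)) * epowr (a j) b \<partial>count_space (Z \<inter> {k..})))"
        by (intro mult_left_mono c) simp
      also have "\<dots> = c * (\<integral>\<^sup>+j. ennreal (2 powi k) * (ennreal (2 powr (real_of_int (j - k) / 2)) * epowr (a j) b) \<partial>count_space (Z \<inter> {k..}))"
        by (subst nn_integral_cmult) (simp_all add: mult.left_commute)
      also have "(\<integral>\<^sup>+j. ennreal (2 powi k) * (ennreal (2 powr (real_of_int (j - k) / 2)) * epowr (a j) b) \<partial>count_space (Z \<inter> {k..}))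
         = (\<integral>\<^sup>+j. A j * ennreal (2 powr ((1 / 2) * real_of_int (k - j))) \<partial>count_space (Z \<inter> {k..}))"
      proof (rule nn_integral_cong)
        fix j
        have "ennreal (2 powi k) * ennreal (2 powr (real_of_int (j - k) / 2))
            = ennreal (2 powi j) * ennreal (2 powr ((1 / 2) * real_of_int (k - j)))"
          by (simp add: ennreal_mult[symmetric] powr_real_of_int'[symmetric] powr_add[symmetric])
            (simp add: field_simps)
        then show "ennreal (2 powi k) * (ennreal (2 powr (real_of_int (j - k) / 2)) * epowr (a j) b)
            = A j * ennreal (2 powr ((1 / 2) * real_of_int (k - j)))"
          by (simp add: A_def mult_ac)
      qed
      also have "\<dots> = ?R"
        by (subst (1 2) nn_integral_count_space_indicator)
          (auto intro!: nn_integral_cong simp: indicator_def)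
      finally show ?thesis .
    qed
    then have "(\<integral>\<^sup>+k. ennreal (2 powi k) * epowr (\<integral>\<^sup>+j. a j \<partial>count_space (Z \<inter> {k..})) b \<partial>count_space Z)
      \<le> (\<integral>\<^sup>+k. c * (\<integral>\<^sup>+j. A j * ennreal (2 powr ((1 / 2) * real_of_int (k - j))) * indicator {..j} k \<partial>count_space Z) \<partial>count_space Z)"
      by (intro nn_integral_mono)
    also have "\<dots> = c * (\<integral>\<^sup>+k. \<integral>\<^sup>+j. A j * ennreal (2 powr ((1 / 2) * real_of_int (k - j))) * indicator {..j} k \<partial>count_space Z \<partial>count_space Z)"
      by (rule nn_integral_cmult) simp
    also have "\<dots> = c * (\<integral>\<^sup>+j. \<integral>\<^sup>+k. A j * ennreal (2 powr ((1 / 2) * real_of_int (k - j))) * indicator {..j} k \<partial>count_space Z \<partial>count_space Z)"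
      by (subst nn_integral_count_space_nn_integral) auto
    also have "\<dots> \<le> c * (\<integral>\<^sup>+j. A j * c' \<partial>count_space Z)"
    proof (intro mult_left_mono nn_integral_mono)
      fix j
      have "(\<integral>\<^sup>+k. A j * ennreal (2 powr ((1 / 2) * real_of_int (k - j))) * indicator {..j} k \<partial>count_space Z)
         \<le> (\<integral>\<^sup>+k. A j * ennreal (2 powr ((1 / 2) * real_of_int (k - j))) * indicator {..j} k \<partial>count_space UNIV)"
        by (rule nn_integral_count_space_mono_set) simp
      also have "\<dots> = A j * (\<integral>\<^sup>+k. ennreal (2 powr ((1 / 2) * real_of_int (k - j))) \<partial>count_space {..j})"
        by (subst nn_integral_cmult[symmetric], simp, subst nn_integral_count_space_indicator) simp_all
      also have "\<dots> = A j * c'" by (simp only: c')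
      finally show "(\<integral>\<^sup>+k. A j * ennreal (2 powr ((1 / 2) * real_of_int (k - j))) * indicator {..j} k \<partial>count_space Z) \<le> A j * c'" .
    qed simp
    also have "\<dots> = c * c' * (\<integral>\<^sup>+j. A j \<partial>count_space Z)"
      by (subst nn_integral_multc) (simp_all add: mult_ac)
    finally show "(\<integral>\<^sup>+k. ennreal (2 powi k) * epowr (\<integral>\<^sup>+j. a j \<partial>count_space (Z \<inter> {k..})) b \<partial>count_space Z)
      \<le> c * c' * (\<integral>\<^sup>+j. ennreal (2 powi j) * epowr (a j) b \<partial>count_space Z)"
      unfolding A_def .
  qed
qed

section \<open>Covering sequences\<close>

locale covering =
  fixes u :: "real \<Rightarrow> ennreal" and Z :: "int set" and x :: "int \<Rightarrow> ereal"
  assumes weight: "u \<in> weights" and covering: "covering_sequence u Z x"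
begin

lemma u_Mplus: "u \<in> Mplus"
  using weight by (simp add: weights_def)

lemma pred_in_Z: "k \<in> Z \<Longrightarrow> k - 1 \<in> Z"
  using covering by (auto simp: covering_sequence_def)

lemma x_pos: "k \<in> Z \<Longrightarrow> 0 < x k"
  using covering by (auto simp: covering_sequence_def)

lemma lint_to_x: "k \<in> Z \<Longrightarrow> lint 0 (x k) u = ennreal (2 powi k)"
  using covering by (auto simp: covering_sequence_def)

lemma x_less:
  assumes "j \<in> Z" "k \<in> Z" "j < k"
  shows "x j < x k"
proof -
  have "strict_mono_on Z x"
    using covering by (auto simp: covering_sequence_def)
  then show ?thesis using assms by (rule strict_mono_onD)
qed

text \<open>The pieces \<open>(x k, x (k + 1))\<close> for \<open>k \<in> Z\<close> are pairwise disjoint. For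
  \<open>j < k\<close> in \<open>Z\<close> the index \<open>j + 1 \<le> k\<close> lies in \<open>Z\<close> as well, also when \<open>Z\<close> is bounded above, so that
  strict monotonicity applies to it.\<close>

lemma x_step:
  assumes "j \<in> Z" "k \<in> Z" "j < k"
  shows "x (j + 1) \<le> x k"
proof -
  have "j + 1 \<in> Z"
    using covering assms by (auto simp: covering_sequence_def)
  then show ?thesis
    using x_less[of "j + 1" k] assms by (cases "j + 1 = k") auto
qed

lemma x_Suc_top:
  assumes "k \<in> Z" "k + 1 \<notin> Z"
  shows "x (k + 1) = \<infinity>"
proof -
  from assms covering obtain M where M: "Z = {..M}" "x (M + 1) = \<infinity>"
    unfolding covering_sequence_def by auto
  with assms have "k = M" by auto
  with M show ?thesis by simp
qed

lemma x_Suc_le: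
  assumes "k \<in> Z"
  shows "x k \<le> x (k + 1)"
  using x_less[of k "k + 1"] x_Suc_top[of k] assms by (cases "k + 1 \<in> Z") auto

lemma lint_to_x_Suc_le:
  assumes "k \<in> Z"
  shows "lint 0 (x (k + 1)) u \<le> ennreal (2 powi (k + 1))"
proof (cases "k + 1 \<in> Z")
  case True
  then show ?thesis by (simp add: lint_to_x)
next
  case False
  with assms covering obtain M where M: "Z = {..M}" "x (M + 1) = \<infinity>"
      "lint 0 \<infinity> u < ennreal (2 powi (M + 1))"
    unfolding covering_sequence_def by auto
  with assms False have "k = M" by auto
  with M show ?thesis by simp
qed

text \<open>Only an upper bound is available for the mass of a piece: the last piece of a bounded index set
  may carry arbitrarily little mass. The piece before \<open>x k\<close> has mass exactly \<open>2 powi (k - 1)\<close>, so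
  lower bounds are obtained by shifting the index.\<close>

lemma lint_piece_le:
  assumes "k \<in> Z"
  shows "lint (x k) (x (k + 1)) u \<le> ennreal (2 powi k)"
proof -
  have "ennreal (2 powi k) + lint (x k) (x (k + 1)) u = lint 0 (x (k + 1)) u"
    using lint_split[OF u_Mplus, of 0 "x k" "x (k + 1)"] assms x_pos[of k] x_Suc_le[of k]
    by (simp add: lint_to_x)
  also have "\<dots> \<le> ennreal (2 powi k) + ennreal (2 powi k)"
    using lint_to_x_Suc_le[OF assms] by (simp add: ennreal_plus[symmetric] power_int_add mult.commute del: ennreal_plus)
  finally show ?thesis
    by (simp add: ennreal_add_left_cancel_le)
qed

lemma lint_previous_piece:
  assumes "k \<in> Z"
  shows "2 * lint (x (k - 1)) (x k) u = ennreal (2 powi k)"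
proof -
  have k': "k - 1 \<in> Z" using assms by (rule pred_in_Z)
  have two: "ennreal (2 powi k) = ennreal (2 powi (k - 1)) + ennreal (2 powi (k - 1))"
    by (simp add: ennreal_plus[symmetric] power_int_diff del: ennreal_plus)
  have "ennreal (2 powi (k - 1)) + lint (x (k - 1)) (x k) u = ennreal (2 powi k)"
    using lint_split[OF u_Mplus, of 0 "x (k - 1)" "x k"] assms k' x_pos[of "k - 1"] x_Suc_le[of "k - 1"]
    by (simp add: lint_to_x)
  then have "lint (x (k - 1)) (x k) u = ennreal (2 powi (k - 1))"
    unfolding two by (simp add: ennreal_add_left_cancel)
  then show ?thesis unfolding two by (simp add: mult_2)
qed

text \<open>The indices \<open>k\<close> with \<open>x k \<le> t\<close> are found by comparing \<open>2 powi k\<close> with the mass of \<open>u\<close> on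
  \<open>(0, t)\<close>, which is positive and finite. Hence there are such indices, they are bounded above, and
  the largest one is the index of the piece that contains \<open>t\<close>.\<close>

lemma ex_piece:
  assumes "0 < t"
  obtains k where "k \<in> Z" "x k \<le> ereal t" "ereal t < x (k + 1)"
proof -
  let ?U = "lint 0 (ereal t) u"
  have U: "0 < ?U" "?U < \<infinity>" using weight assms by (auto simp: weights_def)
  have "\<exists>k\<in>Z. x k \<le> ereal t"
  proof -
    obtain c where c: "?U = ennreal c" "0 < c" using U by (cases ?U) auto
    obtain n where n: "(1 / 2) ^ n < c" using real_arch_pow_inv[OF c(2), of "1 / 2"] by auto
    obtain k where k: "k \<in> Z" "k \<le> - int n"
      using covering unfolding covering_sequence_def
      by (metis UNIV_I atMost_iff linear order_refl)
    have "(2 :: real) powi k \<le> 2 powi (- int n)"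
      using k(2) by (intro power_int_increasing) auto
    also have "\<dots> < c" using n by (simp add: power_int_minus power_one_over inverse_eq_divide)
    finally have "lint 0 (x k) u < ?U" using k c by (simp add: lint_to_x ennreal_lessI)
    then have "x k \<le> ereal t"
      by (metis lint_mono linear order_refl not_le)
    with k show ?thesis by blast
  qed
  then obtain k0 where k0: "k0 \<in> Z" "x k0 \<le> ereal t" by blast
  have "\<exists>N. \<forall>k\<in>Z. x k \<le> ereal t \<longrightarrow> k \<le> N"
  proof -
    obtain c where c: "?U = ennreal c" "0 < c" using U by (cases ?U) auto
    obtain n where n: "c < 2 ^ n" using real_arch_pow[of 2 c] by auto
    have "k \<le> int n" if "k \<in> Z" "x k \<le> ereal t" for k
    proof (rule ccontr)
      assume "\<not> k \<le> int n"
      then have "(2 :: real) powi (int n) \<le> 2 powi k" by (intro power_int_increasing) auto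
      with n have "c < 2 powi k" by simp
      moreover have "ennreal (2 powi k) \<le> ennreal c"
        using that by (metis c(1) lint_mono lint_to_x order_refl)
      ultimately show False using c by (simp add: ennreal_le_iff)
    qed
    then show ?thesis by blast
  qed
  then obtain N where N: "\<And>k. k \<in> Z \<Longrightarrow> x k \<le> ereal t \<Longrightarrow> k \<le> N" by blast
  define S where "S = {k \<in> Z. k0 \<le> k \<and> x k \<le> ereal t}"
  have "S \<subseteq> {k0..N}" using N by (auto simp: S_def)
  then have fin: "finite S" by (rule finite_subset) simp
  have "k0 \<in> S" using k0 by (simp add: S_def)
  then have max: "Max S \<in> S" using fin by (intro Max_in) auto
  show thesis
  proof
    show "Max S \<in> Z" "x (Max S) \<le> ereal t" using max by (auto simp: S_def)
    show "ereal t < x (Max S + 1)"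
    proof (cases "Max S + 1 \<in> Z")
      case True
      have "Max S + 1 \<notin> S" using Max_ge[OF fin, of "Max S + 1"] by auto
      with True max show ?thesis by (auto simp: S_def)
    next
      case False
      then show ?thesis using \<open>Max S \<in> Z\<close> by (simp add: x_Suc_top)
    qed
  qed
qed

lemma lint_eq_sum_pieces:
  assumes "f \<in> Mplus"
  shows "lint 0 \<infinity> f = (\<integral>\<^sup>+k. lint (x k) (x (k + 1)) f \<partial>count_space Z)"
proof (rule antisym)
  show "lint 0 \<infinity> f \<le> (\<integral>\<^sup>+k. lint (x k) (x (k + 1)) f \<partial>count_space Z)"
  proof (rule lint_le_sum[OF assms countableI_type])
    fix t assume "0 < ereal t"
    then obtain k where "k \<in> Z" "x k \<le> ereal t" "ereal t < x (k + 1)"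
      using ex_piece[of t] by auto
    then show "ereal t \<in> x ` Z \<or> (\<exists>k\<in>Z. x k < ereal t \<and> ereal t < x (k + 1))"
      by (metis image_eqI order_le_less)
  qed (simp add: x_pos less_imp_le)
  show "(\<integral>\<^sup>+k. lint (x k) (x (k + 1)) f \<partial>count_space Z) \<le> lint 0 \<infinity> f"
    using x_step x_pos by (intro sum_lint_le assms) (auto simp: less_imp_le neq_iff)
qed

lemma lint_tail_le_sum_pieces:
  assumes "f \<in> Mplus" "k \<in> Z"
  shows "lint (x k) \<infinity> f \<le> (\<integral>\<^sup>+j. lint (x j) (x (j + 1)) f \<partial>count_space (Z \<inter> {k..}))"
proof (rule lint_le_sum[OF assms(1)])
  fix t assume t: "x k < ereal t"
  moreover from this x_pos[OF assms(2)] have "0 < t"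
    using less_trans by fastforce
  ultimately obtain j where j: "j \<in> Z" "x j \<le> ereal t" "ereal t < x (j + 1)"
    using ex_piece[of t] by auto
  have "k \<le> j"
  proof (rule ccontr)
    assume "\<not> k \<le> j"
    then have "x (j + 1) \<le> x k" using j assms by (intro x_step) auto
    with t j(3) show False by simp
  qed
  with j show "ereal t \<in> x ` (Z \<inter> {k..}) \<or> (\<exists>j\<in>Z \<inter> {k..}. x j < ereal t \<and> ereal t < x (j + 1))"
    by (metis IntI atLeast_iff image_eqI order_le_less)
qed (auto simp: x_pos less_imp_le)

text \<open>Discretisation from below: \<open>2 powi k\<close> is twice the mass of \<open>u\<close> on the piece that ends at \<open>x k\<close>.
  For an antitone \<open>g\<close>, the value at \<open>x k\<close> is a lower bound of \<open>g\<close> on that piece.\<close>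

lemma sum_le_weighted_integral:
  assumes "g \<in> Mplus" 
    and c: "\<And>k y. k \<in> Z \<Longrightarrow> x (k - 1) < ereal y \<Longrightarrow> ereal y < x k \<Longrightarrow> c k \<le> g y"
  shows "(\<integral>\<^sup>+k. ennreal (2 powi k) * c k \<partial>count_space Z) \<le> 2 * lint 0 \<infinity> (\<lambda>y. g y * u y)"
proof -
  have "ennreal (2 powi k) * c k \<le> 2 * lint (x (k - 1)) (x k) (\<lambda>y. g y * u y)" if k: "k \<in> Z" for k
  proof -
    have "ennreal (2 powi k) * c k = 2 * (c k * lint (x (k - 1)) (x k) u)"
      using lint_previous_piece[OF k] by (simp add: mult_ac flip: mult.assoc)
    also have "c k * lint (x (k - 1)) (x k) u = lint (x (k - 1)) (x k) (\<lambda>y. c k * u y)"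
      using x_pos[OF pred_in_Z[OF k]] by (intro lint_cmult[symmetric] u_Mplus) simp
    also have "\<dots> \<le> lint (x (k - 1)) (x k) (\<lambda>y. g y * u y)"
      using k by (intro lint_mono mult_right_mono c) auto
    finally show ?thesis by (simp add: mult_left_mono)
  qed
  then have "(\<integral>\<^sup>+k. ennreal (2 powi k) * c k \<partial>count_space Z)
      \<le> (\<integral>\<^sup>+k. 2 * lint (x (k - 1)) (x k) (\<lambda>y. g y * u y) \<partial>count_space Z)"
    by (intro nn_integral_mono) simp
  also have "\<dots> = 2 * (\<integral>\<^sup>+k. lint (x (k - 1)) (x k) (\<lambda>y. g y * u y) \<partial>count_space Z)"
    by (rule nn_integral_cmult) simp
  also have "\<dots> \<le> 2 * lint 0 \<infinity> (\<lambda>y. g y * u y)"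
  proof (intro mult_left_mono sum_lint_le Mplus_mult assms u_Mplus countableI_type)
    fix i k assume "i \<in> Z" "k \<in> Z" "i \<noteq> k"
    then show "x i \<le> x (k - 1) \<or> x k \<le> x (i - 1)"
      using x_step[of "i - 1" "k - 1"] x_step[of "k - 1" "i - 1"] pred_in_Z by (auto simp: neq_iff)
  qed (auto simp: x_pos pred_in_Z less_imp_le)
  finally show ?thesis .
qed

text \<open>Discretisation from above: on the piece that starts at \<open>x k\<close>, the weight \<open>u\<close> has mass at most
  \<open>2 powi k\<close>, and \<open>c k\<close> bounds \<open>g\<close> there.\<close>

lemma weighted_integral_le_sum:
  assumes "g \<in> Mplus"
    and c: "\<And>k y. k \<in> Z \<Longrightarrow> x k < ereal y \<Longrightarrow> g y \<le> c k"
  shows "lint 0 \<infinity> (\<lambda>y. g y * u y) \<le> (\<integral>\<^sup>+k. ennreal (2 powi k) * c k \<partial>count_space Z)"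
proof -
  have "lint (x k) (x (k + 1)) (\<lambda>y. g y * u y) \<le> ennreal (2 powi k) * c k" if k: "k \<in> Z" for k
  proof -
    have "lint (x k) (x (k + 1)) (\<lambda>y. g y * u y) \<le> lint (x k) (x (k + 1)) (\<lambda>y. c k * u y)"
      using k by (intro lint_mono mult_right_mono c) auto
    also have "\<dots> = c k * lint (x k) (x (k + 1)) u"
      using x_pos[OF k] by (intro lint_cmult u_Mplus) simp
    also have "\<dots> \<le> c k * ennreal (2 powi k)"
      by (intro mult_left_mono lint_piece_le k) simp
    finally show ?thesis by (simp add: mult.commute)
  qed
  then show ?thesis
    using assms by (subst lint_eq_sum_pieces) (auto intro!: Mplus_mult u_Mplus nn_integral_mono)
qed

end

section \<open>Hardy operators\<close>

lemma Hardy_integrand_Mplus: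
  assumes "w \<in> Mplus"
  shows "(\<lambda>t. epowr (lint a (ereal t) h) q * w t) \<in> Mplus"
  by (rule Mplus_mult[OF Mplus_epowr[OF Mplus_mono[OF lint_mono_right]] assms])

text \<open>Replace the inner integral by its value at \<open>s\<close>, which is a lower bound on \<open>(s, \<infinity>)\<close>, and
  enlarge the range of integration. Taking the supremum over \<open>s\<close> shows that the operator with the supremum is dominated
  pointwise by the original one.\<close>

lemma sup_kernel_le:
  assumes "0 < q" "w \<in> Mplus" "0 \<le> y" "y \<le> s"
  shows "epowr (lint (ereal s) \<infinity> w) (1 / q) * lint 0 (ereal s) h
    \<le> epowr (lint (ereal y) \<infinity> (\<lambda>t. epowr (lint 0 (ereal t) h) q * w t)) (1 / q)"
proof -
  have "epowr (lint 0 (ereal s) h) q * lint (ereal s) \<infinity> w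
      = lint (ereal s) \<infinity> (\<lambda>t. epowr (lint 0 (ereal s) h) q * w t)"
    using assms by (intro lint_cmult[symmetric]) auto
  also have "\<dots> \<le> lint (ereal y) \<infinity> (\<lambda>t. epowr (lint 0 (ereal t) h) q * w t)"
    using assms by (intro lint_mono mult_right_mono epowr_mono) auto
  finally have "epowr (epowr (lint 0 (ereal s) h) q * lint (ereal s) \<infinity> w) (1 / q)
      \<le> epowr (lint (ereal y) \<infinity> (\<lambda>t. epowr (lint 0 (ereal t) h) q * w t)) (1 / q)"
    using assms by (intro epowr_mono) auto
  then show ?thesis
    using assms by (simp add: epowr_mult epowr_epowr mult.commute)
qed

lemma antimono_epowr:
  assumes "antimono f" "0 < a"
  shows "antimono (\<lambda>y. epowr (f y) a)"
  using assms by (intro antimonoI epowr_mono antimonoD[OF assms(1)])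

context covering
begin

lemma lnorm_pieces:
  assumes "0 < p" "f \<in> Mplus"
  shows "lnorm p Z (\<lambda>n. epowr (lint (x n) (x (n + 1)) f) (1 / p)) = epowr (lint 0 \<infinity> f) (1 / p)"
  using assms by (simp add: lnorm_def epowr_epowr lint_eq_sum_pieces)

text \<open>The local operators see less of \<open>h\<close> and integrate over a shorter interval than the original
  operator at any point \<open>y < x k\<close>.\<close>

lemma local_part_le:
  assumes "0 < q" "0 < r" and w: "w \<in> Mplus"
  shows "(\<integral>\<^sup>+k. ennreal (2 powi k) *
      epowr (lint (x k) (x (k + 1)) (\<lambda>t. epowr (lint (x k) (ereal t) h) q * w t)) (r / q) \<partial>count_space Z)
    \<le> 2 * lint 0 \<infinity> (\<lambda>y. epowr (lint (ereal y) \<infinity> (\<lambda>t. epowr (lint 0 (ereal t) h) q * w t)) (r / q) * u y)"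
proof (rule sum_le_weighted_integral)
  show "(\<lambda>y. epowr (lint (ereal y) \<infinity> (\<lambda>t. epowr (lint 0 (ereal t) h) q * w t)) (r / q)) \<in> Mplus"
    using assms by (intro Mplus_antimono antimono_epowr lint_antimono_left) auto
  fix k y assume k: "k \<in> Z" and y: "ereal y < x k"
  show "epowr (lint (x k) (x (k + 1)) (\<lambda>t. epowr (lint (x k) (ereal t) h) q * w t)) (r / q)
    \<le> epowr (lint (ereal y) \<infinity> (\<lambda>t. epowr (lint 0 (ereal t) h) q * w t)) (r / q)"
    using assms y x_pos[OF k] by (intro epowr_mono lint_mono mult_right_mono) auto
qed

text \<open>The mass of \<open>h\<close> collected before \<open>x k\<close> enters the piece \<open>(x k, x (k + 1))\<close> as a constant. Its
  contribution is bounded by the term \<open>s = x k\<close> of the supremum, which is admissible for all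
  \<open>y < x k\<close>.\<close>

lemma boundary_part_le:
  assumes "0 < q" "0 < r"
  shows "(\<integral>\<^sup>+k. ennreal (2 powi k) *
      epowr (epowr (lint 0 (x k) h) q * lint (x k) (x (k + 1)) w) (r / q) \<partial>count_space Z)
    \<le> 2 * lint 0 \<infinity> (\<lambda>y. u y *
        epowr (SUP s\<in>{y..}. epowr (lint (ereal s) \<infinity> w) (1 / q) * lint 0 (ereal s) h) r)"
proof -
  define G where "G y = (SUP s\<in>{y..}. epowr (lint (ereal s) \<infinity> w) (1 / q) * lint 0 (ereal s) h)" for y
  have "(\<integral>\<^sup>+k. ennreal (2 powi k) *
      epowr (epowr (lint 0 (x k) h) q * lint (x k) (x (k + 1)) w) (r / q) \<partial>count_space Z)
    \<le> 2 * lint 0 \<infinity> (\<lambda>y. epowr (G y) r * u y)"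
  proof (rule sum_le_weighted_integral)
    have "antimono G"
      unfolding G_def by (intro antimonoI SUP_subset_mono) auto
    then show "(\<lambda>y. epowr (G y) r) \<in> Mplus"
      using assms by (intro Mplus_antimono antimono_epowr)
    fix k y assume k: "k \<in> Z" and y: "ereal y < x k"
    show "epowr (epowr (lint 0 (x k) h) q * lint (x k) (x (k + 1)) w) (r / q) \<le> epowr (G y) r"
    proof (cases "x k = \<infinity>")
      \<comment> \<open>The last point of a bounded index set may be infinite; its piece is empty.\<close>
      case True
      then show ?thesis by (simp add: lint_empty)
    next
      case False
      then obtain s where s: "x k = ereal s" using x_pos[OF k] by (cases "x k") auto
      have "lint (x k) (x (k + 1)) w \<le> lint (ereal s) \<infinity> w"
        unfolding s by (intro lint_mono) auto
      then have "epowr (epowr (lint 0 (x k) h) q * lint (x k) (x (k + 1)) w) (r / q)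
          \<le> epowr (epowr (lint 0 (ereal s) h) q * lint (ereal s) \<infinity> w) (r / q)"
        unfolding s using assms by (intro epowr_mono mult_left_mono) auto
      also have "\<dots> = epowr (epowr (lint (ereal s) \<infinity> w) (1 / q) * lint 0 (ereal s) h) r"
        using assms by (simp add: epowr_mult epowr_epowr mult.commute)
      also have "\<dots> \<le> epowr (G y) r"
        unfolding G_def using assms y s by (intro epowr_mono SUP_upper) auto
      finally show ?thesis .
    qed
  qed
  then show ?thesis by (simp add: G_def mult.commute)
qed

text \<open>On the piece, \<open>\<integral>\<^sub>0\<^sup>t h\<close> splits at \<open>x k\<close> into the local integral and a constant.\<close>

lemma piece_le:
  assumes "0 < q" and w: "w \<in> Mplus" and h: "h \<in> Mplus" and k: "k \<in> Z"
  shows "lint (x k) (x (k + 1)) (\<lambda>t. epowr (lint 0 (ereal t) h) q * w t)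
    \<le> ennreal (2 powr q) * (lint (x k) (x (k + 1)) (\<lambda>t. epowr (lint (x k) (ereal t) h) q * w t)
        + epowr (lint 0 (x k) h) q * lint (x k) (x (k + 1)) w)"
proof -
  let ?A = "\<lambda>t. epowr (lint (x k) (ereal t) h) q * w t"
  let ?B = "\<lambda>t. epowr (lint 0 (x k) h) q * w t"
  have x0: "0 \<le> x k" using x_pos[OF k] by simp
  have A: "?A \<in> Mplus" using assms by (intro Hardy_integrand_Mplus)
  have B: "?B \<in> Mplus" using w by (simp add: Mplus_def)
  have AB: "(\<lambda>t. ?A t + ?B t) \<in> Mplus" using A B by (simp add: Mplus_def)
  have "lint (x k) (x (k + 1)) (\<lambda>t. epowr (lint 0 (ereal t) h) q * w t)
    \<le> lint (x k) (x (k + 1)) (\<lambda>t. ennreal (2 powr q) * (?A t + ?B t))"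
  proof (rule lint_mono)
    fix t assume "x k < ereal t"
    then have "lint 0 (ereal t) h = lint (x k) (ereal t) h + lint 0 (x k) h"
      using x0 by (subst lint_split[OF h, of 0 "x k"]) (auto simp: add.commute)
    then have "epowr (lint 0 (ereal t) h) q
        \<le> ennreal (2 powr q) * (epowr (lint (x k) (ereal t) h) q + epowr (lint 0 (x k) h) q)"
      using epowr_add_le[OF assms(1)] by simp
    from mult_right_mono[OF this, of "w t"]
    show "epowr (lint 0 (ereal t) h) q * w t \<le> ennreal (2 powr q) * (?A t + ?B t)"
      by (simp add: distrib_right mult.assoc)
  qed auto
  also have "\<dots> = ennreal (2 powr q) * (lint (x k) (x (k + 1)) ?A
      + epowr (lint 0 (x k) h) q * lint (x k) (x (k + 1)) w)"
    using A B AB w x0 by (simp add: lint_cmult lint_add)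
  finally show ?thesis .
qed

text \<open>The hard half of the equivalence. The discretisation from above produces tails of the sequence
  of integrals over single pieces, the discrete Hardy inequality removes the tails, and each
  remaining piece splits into its local part and its boundary part.\<close>

lemma operator_le_parts:
  assumes "0 < q" "0 < r" and w: "w \<in> Mplus"
  shows "\<exists>c<\<infinity>. \<forall>h\<in>Mplus.
    lint 0 \<infinity> (\<lambda>y. epowr (lint (ereal y) \<infinity> (\<lambda>t. epowr (lint 0 (ereal t) h) q * w t)) (r / q) * u y)
    \<le> c * ((\<integral>\<^sup>+k. ennreal (2 powi k) *
            epowr (lint (x k) (x (k + 1)) (\<lambda>t. epowr (lint (x k) (ereal t) h) q * w t)) (r / q) \<partial>count_space Z)
         + lint 0 \<infinity> (\<lambda>y. u y *
            epowr (SUP s\<in>{y..}. epowr (lint (ereal s) \<infinity> w) (1 / q) * lint 0 (ereal s) h) r))"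
proof -
  have rq: "0 < r / q" using assms by simp
  obtain c where c: "c < \<infinity>"
    "\<And>(a :: int \<Rightarrow> ennreal) Z.
       (\<integral>\<^sup>+k. ennreal (2 powi k) * epowr (\<integral>\<^sup>+j. a j \<partial>count_space (Z \<inter> {k..})) (r / q) \<partial>count_space Z)
       \<le> c * (\<integral>\<^sup>+j. ennreal (2 powi j) * epowr (a j) (r / q) \<partial>count_space Z)"
    by (rule discrete_hardy[OF rq], rule that)
  define d where "d = epowr (ennreal (2 powr q)) (r / q) * ennreal (2 powr (r / q))"
  have d: "d < \<infinity>" by (simp add: d_def ennreal_mult_less_top epowr_ennreal)
  show ?thesis
  proof (intro exI[of _ "c * (d * 2)"] conjI ballI)
    show "c * (d * 2) < \<infinity>" using c(1) d by (simp add: ennreal_mult_less_top)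
    fix h assume h: "h \<in> Mplus"
    define f where "f t = epowr (lint 0 (ereal t) h) q * w t" for t
    define a where "a k = lint (x k) (x (k + 1)) f" for k
    define A where "A k = lint (x k) (x (k + 1)) (\<lambda>t. epowr (lint (x k) (ereal t) h) q * w t)" for k
    define B where "B k = epowr (lint 0 (x k) h) q * lint (x k) (x (k + 1)) w" for k
    define S where "S = (\<integral>\<^sup>+k. ennreal (2 powi k) * epowr (A k) (r / q) \<partial>count_space Z)"
    define T where "T = lint 0 \<infinity> (\<lambda>y. u y *
            epowr (SUP s\<in>{y..}. epowr (lint (ereal s) \<infinity> w) (1 / q) * lint 0 (ereal s) h) r)"
    have f: "f \<in> Mplus" unfolding f_def using assms by (intro Hardy_integrand_Mplus)
    have a: "epowr (a k) (r / q) \<le> d * (epowr (A k) (r / q) + epowr (B k) (r / q))" if k: "k \<in> Z" for k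
    proof -
      have "epowr (a k) (r / q) \<le> epowr (ennreal (2 powr q) * (A k + B k)) (r / q)"
        unfolding a_def f_def A_def B_def
        by (intro epowr_mono rq piece_le assms h k)
      also have "\<dots> \<le> epowr (ennreal (2 powr q)) (r / q) 
          * (ennreal (2 powr (r / q)) * (epowr (A k) (r / q) + epowr (B k) (r / q)))"
        unfolding epowr_mult[OF rq] by (intro mult_left_mono epowr_add_le rq) simp
      finally show ?thesis by (simp add: d_def mult.assoc)
    qed
    have "lint 0 \<infinity> (\<lambda>y. epowr (lint (ereal y) \<infinity> f) (r / q) * u y)
        \<le> (\<integral>\<^sup>+k. ennreal (2 powi k) * epowr (\<integral>\<^sup>+j. a j \<partial>count_space (Z \<inter> {k..})) (r / q) \<partial>count_space Z)"
    proof (rule weighted_integral_le_sum)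
      show "(\<lambda>y. epowr (lint (ereal y) \<infinity> f) (r / q)) \<in> Mplus"
        by (intro Mplus_antimono antimono_epowr lint_antimono_left rq)
      fix k y assume k: "k \<in> Z" and y: "x k < ereal y"
      have "lint (ereal y) \<infinity> f \<le> lint (x k) \<infinity> f"
        using y by (intro lint_mono) auto
      also have "\<dots> \<le> (\<integral>\<^sup>+j. a j \<partial>count_space (Z \<inter> {k..}))"
        unfolding a_def by (rule lint_tail_le_sum_pieces[OF f k])
      finally show "epowr (lint (ereal y) \<infinity> f) (r / q) \<le> epowr (\<integral>\<^sup>+j. a j \<partial>count_space (Z \<inter> {k..})) (r / q)"
        by (rule epowr_mono[OF rq])
    qed
    also have "\<dots> \<le> c * (\<integral>\<^sup>+k. ennreal (2 powi k) * epowr (a k) (r / q) \<partial>count_space Z)"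
      by (rule c)
    also have "\<dots> \<le> c * (d * (S + 2 * T))"
    proof (rule mult_left_mono)
      have "(\<integral>\<^sup>+k. ennreal (2 powi k) * epowr (a k) (r / q) \<partial>count_space Z)
          \<le> (\<integral>\<^sup>+k. ennreal (2 powi k) * (d * (epowr (A k) (r / q) + epowr (B k) (r / q))) \<partial>count_space Z)"
        by (intro nn_integral_mono mult_left_mono a) auto
      also have "\<dots> = (\<integral>\<^sup>+k. d * (ennreal (2 powi k) * epowr (A k) (r / q) + ennreal (2 powi k) * epowr (B k) (r / q)) \<partial>count_space Z)"
        by (simp add: algebra_simps)
      also have "\<dots> = d * (S + (\<integral>\<^sup>+k. ennreal (2 powi k) * epowr (B k) (r / q) \<partial>count_space Z))"
        by (simp add: nn_integral_cmult nn_integral_add S_def)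
      also have "\<dots> \<le> d * (S + 2 * T)"
        unfolding B_def T_def by (intro mult_left_mono add_left_mono boundary_part_le assms) simp
      finally show "(\<integral>\<^sup>+k. ennreal (2 powi k) * epowr (a k) (r / q) \<partial>count_space Z) \<le> d * (S + 2 * T)" .
    qed simp
    also have "\<dots> \<le> c * (d * (2 * (S + T)))"
      by (intro mult_left_mono) (simp_all add: distrib_left mult_2 add_increasing)
    also have "\<dots> = c * (d * 2) * (S + T)"
      by (simp add: mult.assoc)
    finally show "lint 0 \<infinity> (\<lambda>y. epowr (lint (ereal y) \<infinity> (\<lambda>t. epowr (lint 0 (ereal t) h) q * w t)) (r / q) * u y)
      \<le> c * (d * 2) * ((\<integral>\<^sup>+k. ennreal (2 powi k) *
            epowr (lint (x k) (x (k + 1)) (\<lambda>t. epowr (lint (x k) (ereal t) h) q * w t)) (r / q) \<partial>count_space Z)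
         + lint 0 \<infinity> (\<lambda>y. u y *
            epowr (SUP s\<in>{y..}. epowr (lint (ereal s) \<infinity> w) (1 / q) * lint 0 (ereal s) h) r))"
      unfolding f_def S_def T_def A_def .
  qed
qed

end

lemma lnorm_dyadic:
  assumes "0 < r"
  shows "lnorm r Z (\<lambda>k. ennreal (2 powr (real_of_int k / r)) * epowr (A k) (1 / q))
    = epowr (\<integral>\<^sup>+k. ennreal (2 powi k) * epowr (A k) (r / q) \<partial>count_space Z) (1 / r)"
  using assms by (simp add: lnorm_def epowr_mult epowr_epowr epowr_ennreal powr_powr powr_real_of_int')

theorem theorem3p4:
  fixes p q r :: real and u v w :: "real \<Rightarrow> ennreal" and Z :: "int set" and x :: "int \<Rightarrow> ereal"
  assumes "1 \<le> p" and "0 < q" and "0 < r"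
    and "u \<in> weights" and "v \<in> weights" and "w \<in> weights"
    and "covering_sequence u Z x"
  shows
    "(\<exists>C<\<infinity>. \<forall>h\<in>Mplus.
        epowr (lint 0 \<infinity> (\<lambda>y.
            epowr (lint y \<infinity> (\<lambda>t. epowr (lint 0 t h) q * w t)) (r / q) * u y)) (1 / r)
        \<le> C * epowr (lint 0 \<infinity> (\<lambda>t. epowr (h t) p * v t)) (1 / p))
     \<longleftrightarrow>
     (\<exists>C<\<infinity>. \<forall>h\<in>Mplus.
        lnorm r Z (\<lambda>k. ennreal (2 powr (real_of_int k / r)) *
            epowr (lint (x k) (x (k + 1)) (\<lambda>t. epowr (lint (x k) t h) q * w t)) (1 / q))
        \<le> C * lnorm p Z (\<lambda>n. epowr (lint (x n) (x (n + 1)) (\<lambda>t. epowr (h t) p * v t)) (1 / p)))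
     \<and>
     (\<exists>C<\<infinity>. \<forall>h\<in>Mplus.
        epowr (lint 0 \<infinity> (\<lambda>y. u y *
            epowr (SUP s\<in>{y..}. epowr (lint s \<infinity> w) (1 / q) * lint 0 s h) r)) (1 / r)
        \<le> C * epowr (lint 0 \<infinity> (\<lambda>t. epowr (h t) p * v t)) (1 / p))"
proof -
  interpret covering u Z x using assms by unfold_locales
  have w: "w \<in> Mplus" and v: "v \<in> Mplus" using assms by (auto simp: weights_def)
  have r: "0 < 1 / r" using assms by simp
  define N where "N h = epowr (lint 0 \<infinity> (\<lambda>t. epowr (h t) p * v t)) (1 / p)" for h
  define I where "I h = lint 0 \<infinity> (\<lambda>y.
    epowr (lint (ereal y) \<infinity> (\<lambda>t. epowr (lint 0 (ereal t) h) q * w t)) (r / q) * u y)" for h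
  define S where "S h = (\<integral>\<^sup>+k. ennreal (2 powi k) *
    epowr (lint (x k) (x (k + 1)) (\<lambda>t. epowr (lint (x k) (ereal t) h) q * w t)) (r / q) \<partial>count_space Z)" for h
  define T where "T h = lint 0 \<infinity> (\<lambda>y. u y *
    epowr (SUP s\<in>{y..}. epowr (lint (ereal s) \<infinity> w) (1 / q) * lint 0 (ereal s) h) r)" for h
  have N_pieces: "lnorm p Z (\<lambda>n. epowr (lint (x n) (x (n + 1)) (\<lambda>t. epowr (h t) p * v t)) (1 / p)) = N h"
    if "h \<in> Mplus" for h
    unfolding N_def using assms that by (intro lnorm_pieces Mplus_mult Mplus_epowr v) auto
  have S_norm: "lnorm r Z (\<lambda>k. ennreal (2 powr (real_of_int k / r)) *
      epowr (lint (x k) (x (k + 1)) (\<lambda>t. epowr (lint (x k) (ereal t) h) q * w t)) (1 / q))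
    = epowr (S h) (1 / r)" for h
    unfolding S_def by (rule lnorm_dyadic[OF assms(3)])
  have pieces: "(\<forall>h\<in>Mplus.
      lnorm r Z (\<lambda>k. ennreal (2 powr (real_of_int k / r)) *
          epowr (lint (x k) (x (k + 1)) (\<lambda>t. epowr (lint (x k) (ereal t) h) q * w t)) (1 / q))
      \<le> C * lnorm p Z (\<lambda>n. epowr (lint (x n) (x (n + 1)) (\<lambda>t. epowr (h t) p * v t)) (1 / p)))
    \<longleftrightarrow> (\<forall>h\<in>Mplus. epowr (S h) (1 / r) \<le> C * N h)" for C
    by (intro ball_cong refl) (simp only: S_norm N_pieces)
  have S_le: "S h \<le> 2 * I h" for h
    unfolding S_def I_def by (intro local_part_le assms w)
  have T_le: "T h \<le> I h" for h
    unfolding T_def I_def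
  proof (rule lint_mono)
    fix y assume y: "0 < ereal y"
    let ?F = "lint (ereal y) \<infinity> (\<lambda>t. epowr (lint 0 (ereal t) h) q * w t)"
    have "(SUP s\<in>{y..}. epowr (lint (ereal s) \<infinity> w) (1 / q) * lint 0 (ereal s) h) \<le> epowr ?F (1 / q)"
      using y assms by (intro SUP_least sup_kernel_le w) auto
    then have "epowr (SUP s\<in>{y..}. epowr (lint (ereal s) \<infinity> w) (1 / q) * lint 0 (ereal s) h) r
        \<le> epowr (epowr ?F (1 / q)) r"
      by (intro epowr_mono assms)
    then show "u y * epowr (SUP s\<in>{y..}. epowr (lint (ereal s) \<infinity> w) (1 / q) * lint 0 (ereal s) h) r
        \<le> epowr ?F (r / q) * u y"
      by (simp add: epowr_epowr mult.commute mult_left_mono)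
  qed auto
  have "\<exists>c<\<infinity>. \<forall>h\<in>Mplus. I h \<le> c * (S h + T h)"
    unfolding I_def S_def T_def by (rule operator_le_parts[OF assms(2,3) w])
  then obtain c where c: "c < \<infinity>" "\<And>h. h \<in> Mplus \<Longrightarrow> I h \<le> c * (S h + T h)" by blast
  have "(\<exists>C<\<infinity>. \<forall>h\<in>Mplus. epowr (I h) (1 / r) \<le> C * N h) \<longleftrightarrow>
     (\<exists>C<\<infinity>. \<forall>h\<in>Mplus. epowr (S h) (1 / r) \<le> C * N h) \<and>
     (\<exists>C<\<infinity>. \<forall>h\<in>Mplus. epowr (T h) (1 / r) \<le> C * N h)" (is "?L \<longleftrightarrow> ?R")
  proof
    assume ?L
    then obtain C where C: "C < \<infinity>" "\<And>h. h \<in> Mplus \<Longrightarrow> epowr (I h) (1 / r) \<le> C * N h" by blast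
    have "epowr (S h) (1 / r) \<le> epowr 2 (1 / r) * C * N h" if "h \<in> Mplus" for h
    proof -
      have "epowr (S h) (1 / r) \<le> epowr 2 (1 / r) * epowr (I h) (1 / r)"
        using epowr_mono[OF r S_le] by (simp add: epowr_mult[OF r])
      also have "\<dots> \<le> epowr 2 (1 / r) * (C * N h)"
        by (intro mult_left_mono C that) simp
      finally show ?thesis by (simp add: mult.assoc)
    qed
    moreover have "epowr 2 (1 / r) * C < \<infinity>"
      using C(1) epowr_finite[of 2 "1 / r"] by (simp add: ennreal_mult_less_top)
    moreover have "epowr (T h) (1 / r) \<le> C * N h" if "h \<in> Mplus" for h
      using epowr_mono[OF r T_le] C(2)[OF that] by (rule order_trans)
    ultimately show ?R using C(1) by blast
  next
    assume ?R
    then obtain C D where C: "C < \<infinity>" "\<And>h. h \<in> Mplus \<Longrightarrow> epowr (S h) (1 / r) \<le> C * N h"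
      and D: "D < \<infinity>" "\<And>h. h \<in> Mplus \<Longrightarrow> epowr (T h) (1 / r) \<le> D * N h" by blast
    let ?K = "epowr c (1 / r) * ennreal (2 powr (1 / r))"
    have "epowr (I h) (1 / r) \<le> ?K * (C + D) * N h" if h: "h \<in> Mplus" for h
    proof -
      have "epowr (I h) (1 / r) \<le> epowr c (1 / r) * epowr (S h + T h) (1 / r)"
        using epowr_mono[OF r c(2)[OF h]] by (simp add: epowr_mult[OF r])
      also have "\<dots> \<le> epowr c (1 / r) * (ennreal (2 powr (1 / r)) * (epowr (S h) (1 / r) + epowr (T h) (1 / r)))"
        by (intro mult_left_mono epowr_add_le r) simp
      also have "\<dots> \<le> epowr c (1 / r) * (ennreal (2 powr (1 / r)) * (C * N h + D * N h))"
        by (intro mult_left_mono add_mono C D h) simp_all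
      finally show ?thesis by (simp add: algebra_simps)
    qed
    moreover have "?K * (C + D) < \<infinity>"
      using c(1) C(1) D(1) epowr_finite[of c "1 / r"] by (simp add: ennreal_mult_less_top)
    ultimately show ?L by blast
  qed
  then show ?thesis
    unfolding pieces I_def T_def N_def .
qed

end
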